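(* Let $S$ be an Arf numerical semigroup minimally generated by $\{n_1<\dots<n_m\}$ with multiplicity $m$ bigger than $5$ and conductor $s$. If $(a_{ij})$ is a row-factorization matrix of the Frobenius number $s-1$, then $a_{ij}=a_{i'j}=0$ for some $i,i',j\in\{1,\dots,m\}$ with $i\neq i'$.
   Context: A numerical semigroup is a subset $S\subseteq\mathbb{N}_0$ (non-negative integers) containing $0$, closed under addition, with finite complement in $\mathbb{N}_0$. The multiplicity is the smallest nonzero element of $S$; the Frobenius number $F(S)$ is the greatest integer not in $S$; the conductor is $F(S)+1$. $S$ is Arf if $s_2+s_3-s_1\in S$ for all $s_1\le s_2\le s_3$ in $S$; an Arf numerical semigroup of multiplicity $m$ has exactly $m$ minimal generators. A row-factorization matrix of $F(S)$ is an $m\times m$ integer matrix $[a_{ij}]$ with $a_{ii}=-1$, $a_{ij}\in\mathbb{N}_0$ for $i\ne j$, and $F(S)=\sum_{j=1}^m a_{ij}n_j$ for each $i$. *)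

theory Defs
  imports Complex_Main
begin

definition add_submonoid :: "nat set \<Rightarrow> bool" where
  "add_submonoid S \<longleftrightarrow> 0 \<in> S \<and> (\<forall>x\<in>S. \<forall>y\<in>S. x + y \<in> S)"

definition numerical_semigroup :: "nat set \<Rightarrow> bool" where
  "numerical_semigroup S \<longleftrightarrow> add_submonoid S \<and> finite (- S)"

definition multiplicity :: "nat set \<Rightarrow> nat" where
  "multiplicity S = (LEAST x. x \<in> S \<and> x \<noteq> 0)"

text \<open>The Frobenius number is taken among the integers, so that it is \<open>-1\<close> for \<open>S = UNIV\<close>.\<close>

definition frobenius_number :: "nat set \<Rightarrow> int" where
  "frobenius_number S = (GREATEST z. z \<notin> int ` S)"

definition conductor :: "nat set \<Rightarrow> int" where
  "conductor S = frobenius_number S + 1"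

text \<open>The subtraction below does not truncate, because \<open>x \<le> y\<close>.\<close>

definition arf :: "nat set \<Rightarrow> bool" where
  "arf S \<longleftrightarrow> (\<forall>x\<in>S. \<forall>y\<in>S. \<forall>z\<in>S. x \<le> y \<and> y \<le> z \<longrightarrow> y + z - x \<in> S)"

definition generates :: "nat set \<Rightarrow> nat set \<Rightarrow> bool" where
  "generates A S \<longleftrightarrow> add_submonoid hull A = S"

definition minimally_generates :: "nat set \<Rightarrow> nat set \<Rightarrow> bool" where
  "minimally_generates A S \<longleftrightarrow> generates A S \<and> (\<forall>B. B \<subset> A \<longrightarrow> \<not> generates B S)"

text \<open>Matrices are functions of two indices, and generators functions of one index; only the
  values at indices in \<open>{1..m}\<close> are relevant.\<close>

definition row_factorization_matrix ::
  "nat \<Rightarrow> (nat \<Rightarrow> nat) \<Rightarrow> int \<Rightarrow> (nat \<Rightarrow> nat \<Rightarrow> int) \<Rightarrow> bool" where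
  "row_factorization_matrix m n f a \<longleftrightarrow>
     (\<forall>i\<in>{1..m}. a i i = -1 \<and> (\<forall>j\<in>{1..m}. j \<noteq> i \<longrightarrow> a i j \<ge> 0) \<and>
        f = (\<Sum>j=1..m. a i j * int (n j)))"

end

theory Submission
  imports Defs
begin

text \<open>
  Write \<open>F\<close> for the Frobenius number. The \<open>m\<close> minimal generators are pairwise incongruent modulo
  the multiplicity \<open>m = n\<^sub>1\<close>, since of two congruent ones the larger would be the smaller plus a
  multiple of \<open>m\<close>. Being \<open>m\<close> in number, they represent all residues modulo \<open>m\<close>, and comparing
  \<open>F + m\<close> with the generator in its class gives \<open>F = n\<^sub>m - n\<^sub>1\<close>
  (\<open>frobenius_number_maximal_embedding_dimension\<close>).

  This determines the first row of the matrix: it expresses the minimal generator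
  \<open>F + n\<^sub>1 = n\<^sub>m\<close> through \<open>n\<^sub>2, \<dots>, n\<^sub>m\<close>, and an indecomposable element has only the trivial
  expression, so \<open>a\<^sub>1\<^sub>j = 0\<close> for \<open>1 < j < m\<close>. In particular \<open>a\<^sub>1\<^sub>4 = 0\<close>, and if row 2 or 3 also
  vanishes in column 4, that row and row 1 are as required. Otherwise both rows are positive in
  column 4, and neither has room for a nonzero entry in the last column as well: for \<open>i = 2, 3\<close> the
  row sum \<open>F + n\<^sub>i = n\<^sub>m - n\<^sub>1 + n\<^sub>i\<close> is less than \<open>n\<^sub>4 + n\<^sub>m\<close>. So both of these rows vanish in the
  last column.
\<close>

section \<open>Minimal generators are the indecomposable elements\<close>

lemma add_submonoid_hull: "add_submonoid (add_submonoid hull A)"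
  by (rule hull_in) (auto simp: add_submonoid_def)

lemma add_submonoid_mult:
  assumes "add_submonoid S" "x \<in> S"
  shows "k * x \<in> S"
  using assms by (induction k) (auto simp: add_submonoid_def)

lemma add_submonoid_sum:
  assumes "add_submonoid S" "\<And>j. j \<in> J \<Longrightarrow> f j \<in> S"
  shows "sum f J \<in> S"
  using assms(2)
  by (induction J rule: infinite_finite_induct) (use assms(1) in \<open>auto simp: add_submonoid_def\<close>)

lemma minimal_generators_subset: "minimally_generates A S \<Longrightarrow> A \<subseteq> S"
  using hull_subset[of A add_submonoid] by (auto simp: minimally_generates_def generates_def)

text \<open>Zero, the generators and the sums of two nonzero elements of \<open>S\<close> together are closed under
  addition, so they already exhaust the submonoid generated by \<open>A\<close>.\<close>

lemma generator_or_decomposable: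
  assumes "generates A S" "x \<in> S" "x \<noteq> 0"
  shows "x \<in> A \<or> (\<exists>u\<in>S - {0}. \<exists>v\<in>S - {0}. x = u + v)"
proof -
  define T where "T = {0} \<union> A \<union> {u + v | u v. u \<in> S - {0} \<and> v \<in> S - {0}}"
  have S: "add_submonoid S" "A \<subseteq> S"
    using assms(1) add_submonoid_hull[of A] hull_subset[of A add_submonoid]
    by (auto simp: generates_def)
  have TS: "T \<subseteq> S"
    using S by (auto simp: T_def add_submonoid_def)
  have "u + v \<in> T" if "u \<in> T" "v \<in> T" for u v
  proof (cases "u = 0 \<or> v = 0")
    case False
    then show ?thesis using that TS unfolding T_def by blast
  qed (use that in auto)
  then have "add_submonoid T"
    by (auto simp: add_submonoid_def T_def)
  then have "S \<subseteq> T"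
    using assms(1) hull_minimal[of A T add_submonoid] by (auto simp: generates_def T_def)
  then show ?thesis
    using assms(2,3) by (auto simp: T_def)
qed

text \<open>Both summands of a decomposition \<open>x = u + v\<close> are smaller than \<open>x\<close>, so neither they nor the
  generators they are made of involve \<open>x\<close>: the other generators already produce \<open>x\<close>.\<close>

lemma minimal_generator_indecomposable:
  assumes min: "minimally_generates A S" and x: "x \<in> A" and uv: "u \<in> S" "v \<in> S" "x = u + v"
  shows "u = 0 \<or> v = 0"
proof (rule ccontr)
  assume nz: "\<not> (u = 0 \<or> v = 0)"
  define H where "H = add_submonoid hull (A - {x})"
  have gen: "generates A S" using min by (simp add: minimally_generates_def)
  have H: "add_submonoid H" "A - {x} \<subseteq> H"
    unfolding H_def by (rule add_submonoid_hull, rule hull_subset)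
  have small: "y \<in> H" if "y \<in> S" "y < x" for y
    using that
  proof (induction y rule: less_induct)
    case (less y)
    show ?case
    proof (cases "y = 0 \<or> y \<in> A")
      case True
      then show ?thesis using H less.prems by (auto simp: add_submonoid_def)
    next
      case False
      then obtain p q where "p \<in> S - {0}" "q \<in> S - {0}" "y = p + q"
        using generator_or_decomposable[OF gen less.prems(1)] by blast
      then have "p \<in> H" "q \<in> H" using less by auto
      then show ?thesis using H \<open>y = p + q\<close> by (auto simp: add_submonoid_def)
    qed
  qed
  have "u \<in> H" "v \<in> H" using small uv nz by auto
  then have "x \<in> H" using H uv by (auto simp: add_submonoid_def)
  then have "A \<subseteq> H" using H by auto
  then have "S \<subseteq> H"
    using gen H hull_minimal[of A H add_submonoid] by (auto simp: generates_def)
  moreover have "H \<subseteq> S"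
    using gen hull_mono[of "A - {x}" A add_submonoid] by (auto simp: generates_def H_def)
  ultimately have "generates (A - {x}) S" by (auto simp: generates_def H_def)
  then show False using min x by (auto simp: minimally_generates_def)
qed

lemma zero_not_minimal_generator:
  assumes "minimally_generates A S"
  shows "0 \<notin> A"
proof
  assume "0 \<in> A"
  define H where "H = add_submonoid hull (A - {0})"
  have H: "add_submonoid H" "A - {0} \<subseteq> H"
    unfolding H_def by (rule add_submonoid_hull, rule hull_subset)
  then have "A \<subseteq> H" by (auto simp: add_submonoid_def)
  then have "add_submonoid hull A \<subseteq> H" using H by (intro hull_minimal)
  moreover have "H \<subseteq> add_submonoid hull A" unfolding H_def by (intro hull_mono) auto
  ultimately have "generates (A - {0}) S"
    using assms by (auto simp: minimally_generates_def generates_def H_def)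
  then show False using assms \<open>0 \<in> A\<close> by (auto simp: minimally_generates_def)
qed

section \<open>The Frobenius number and the multiplicity\<close>

lemma frobenius_number_properties:
  assumes "numerical_semigroup S"
  shows frobenius_number_notin: "frobenius_number S \<notin> int ` S"
    and above_frobenius_number: "frobenius_number S < z \<Longrightarrow> z \<in> int ` S"
proof -
  \<comment> \<open>The integers from \<open>-1\<close> on that lie outside \<open>S\<close> form a finite set, which is nonempty even for
    \<open>S = \<nat>\<close>; its maximum bounds all integers outside \<open>S\<close>.\<close>
  define G where "G = insert (-1) (int ` (- S))"
  have G: "finite G" "G \<noteq> {}"
    using assms by (auto simp: G_def numerical_semigroup_def)
  have notin: "z \<notin> int ` S" if "z \<in> G" for z
    using that by (auto simp: G_def)
  have inG: "z \<in> G \<or> z < -1" if "z \<notin> int ` S" for z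
  proof (cases "z \<ge> 0")
    case True
    then have "nat z \<notin> S" using that by force
    then show ?thesis using True unfolding G_def by (metis ComplI imageI insertI2 nat_0_le)
  qed (auto simp: G_def)
  have ge: "Max G \<ge> -1" using G by (auto simp: G_def)
  have le: "z \<le> Max G" if "z \<notin> int ` S" for z
    using inG[OF that] ge G by force
  have F: "frobenius_number S = Max G"
    unfolding frobenius_number_def
    by (rule Greatest_equality) (use notin le G in auto)
  show "frobenius_number S \<notin> int ` S" using notin F G by auto
  show "z \<in> int ` S" if "frobenius_number S < z" using le[of z] that F by force
qed

lemma multiplicity_properties:
  assumes "numerical_semigroup S"
  shows multiplicity_in: "multiplicity S \<in> S"
    and multiplicity_pos: "multiplicity S > 0"
    and multiplicity_le: "x \<in> S \<Longrightarrow> x \<noteq> 0 \<Longrightarrow> multiplicity S \<le> x"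
proof -
  have "finite (- S)" using assms by (simp add: numerical_semigroup_def)
  then have "infinite (S - {0})"
    using finite_compl infinite_UNIV_nat by fastforce
  then obtain x where "x \<in> S \<and> x \<noteq> 0" by (metis Diff_iff finite.emptyI insertI1 ex_in_conv)
  from LeastI[of "\<lambda>x. x \<in> S \<and> x \<noteq> 0", OF this]
  show "multiplicity S \<in> S" "multiplicity S > 0" by (auto simp: multiplicity_def)
  show "multiplicity S \<le> x" if "x \<in> S" "x \<noteq> 0" for x
    unfolding multiplicity_def using that by (intro Least_le) auto
qed

lemma multiplicity_minimal_generator:
  assumes "numerical_semigroup S" "minimally_generates A S"
  shows "multiplicity S \<in> A"
proof (rule ccontr)
  assume "multiplicity S \<notin> A"
  moreover have "generates A S" using assms(2) by (simp add: minimally_generates_def)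
  ultimately have "\<exists>u\<in>S - {0}. \<exists>v\<in>S - {0}. multiplicity S = u + v"
    using generator_or_decomposable[OF _ multiplicity_in[OF assms(1)], of A]
      multiplicity_pos[OF assms(1)] by simp
  then obtain u v where uv: "u \<in> S - {0}" "v \<in> S - {0}" "multiplicity S = u + v"
    by (elim bexE)
  then show False using multiplicity_le[OF assms(1), of u] by auto
qed

lemma minimal_generators_incongruent:
  assumes S: "add_submonoid S" and min: "minimally_generates A S" and d: "d \<in> S"
  shows "inj_on (\<lambda>x. x mod d) A"
proof -
  have AS: "A \<subseteq> S"
    using min by (rule minimal_generators_subset)
  have *: "x = y" if "x \<in> A" "y \<in> A" "x mod d = y mod d" "x \<le> y" for x y
  proof -
    have "d dvd y - x" using that(3,4) by (metis mod_eq_dvd_iff_nat)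
    then obtain k where k: "y = x + d * k"
      using \<open>x \<le> y\<close> by (metis dvdE le_add_diff_inverse)
    have "d * k \<in> S"
      using add_submonoid_mult[OF S d, of k] by (simp add: mult.commute)
    then have "x = 0 \<or> d * k = 0"
      using minimal_generator_indecomposable[OF min that(2) _ _ k] AS that(1) by auto
    then show "x = y"
      using k zero_not_minimal_generator[OF min] that(1) by auto
  qed
  show ?thesis
  proof (rule inj_onI)
    fix x y assume "x \<in> A" "y \<in> A" "x mod d = y mod d"
    then show "x = y" using *[of x y] *[of y x] by (cases "x \<le> y") auto
  qed
qed

text \<open>The generator congruent to \<open>F + d\<close>, with \<open>d\<close> the multiplicity, can be neither smaller, as then
  \<open>F\<close> would lie in \<open>S\<close>, nor larger, as then subtracting \<open>d\<close> would give an element above \<open>F\<close>,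
  hence in \<open>S\<close>, and make the generator decomposable. By the
  second reason no generator exceeds \<open>F + d\<close> at all. For \<open>S = \<nat>\<close>, where \<open>F + d = 0\<close>, the
  formula fails; so multiplicity 1 is excluded.\<close>

theorem frobenius_number_maximal_embedding_dimension:
  assumes S: "numerical_semigroup S" and min: "minimally_generates A S" and fin: "finite A"
    and card: "card A = multiplicity S" and ge2: "multiplicity S \<ge> 2"
  shows "frobenius_number S = int (Max A) - int (multiplicity S)"
proof -
  define d where "d = multiplicity S"
  define F where "F = frobenius_number S"
  have sub: "add_submonoid S" using S by (simp add: numerical_semigroup_def)
  have AS: "A \<subseteq> S"
    using min by (rule minimal_generators_subset)
  have d: "d \<in> S" "d \<ge> 2" using multiplicity_in[OF S] ge2 by (auto simp: d_def)
  have "1 \<notin> S" using multiplicity_le[OF S, of 1] ge2 by auto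
  then have F1: "F \<ge> 1"
    using above_frobenius_number[OF S, of 1] frobenius_number_notin[OF S] sub
    by (cases "F = 0") (fastforce simp: F_def add_submonoid_def)+
  have bound: "int x \<le> F + int d" if "x \<in> A" for x
  proof (rule ccontr)
    assume "\<not> int x \<le> F + int d"
    then have *: "F < int x - int d" by simp
    then obtain u where u: "u \<in> S" "int x - int d = int u"
      using above_frobenius_number[OF S, of "int x - int d"] by (auto simp: F_def)
    then have "u \<noteq> 0" "x = u + d" using * F1 by auto
    then show False
      using minimal_generator_indecomposable[OF min that u(1) d(1)] d(2) by auto
  qed
  have "(\<lambda>x. x mod d) ` A = {..<d}"
  proof (rule card_subset_eq)
    show "card ((\<lambda>x. x mod d) ` A) = card {..<d}"
      using card_image[OF minimal_generators_incongruent[OF sub min d(1)]] card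
      by (simp add: d_def)
  qed (use d(2) in auto)
  moreover have "(nat F + d) mod d \<in> {..<d}" using d(2) by simp
  ultimately obtain x where x: "x \<in> A" "x mod d = (nat F + d) mod d" by (metis imageE)
  have xle: "x \<le> nat F + d" using bound[OF x(1)] F1 by simp
  then have "d dvd nat F + d - x" using x(2) by (metis mod_eq_dvd_iff_nat)
  then obtain k where k: "nat F + d = x + d * k"
    using xle by (metis dvdE le_add_diff_inverse)
  have "k = 0"
  proof (rule ccontr)
    assume "k \<noteq> 0"
    then have "nat F = x + (k - 1) * d" using k by (cases k) (auto simp: algebra_simps)
    then have "nat F \<in> S"
      using add_submonoid_mult[OF sub d(1), of "k - 1"] x(1) AS sub
      by (auto simp: add_submonoid_def)
    then have "F \<in> int ` S" using F1 by (intro image_eqI[of F int "nat F"]) auto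
    then show False using frobenius_number_notin[OF S] by (simp add: F_def)
  qed
  then have "int x = F + int d" using k F1 by auto
  moreover from this have "Max A = x"
    using bound x(1) fin by (intro Max_eqI) force+
  ultimately show ?thesis by (simp add: F_def d_def)
qed

section \<open>Row-factorization matrices\<close>

text \<open>Subtracting one copy of a generator \<open>n k\<close> that occurs in the combination leaves an element of
  \<open>S\<close>, so indecomposability allows no other generator than \<open>x\<close> itself to occur.\<close>

lemma minimal_generator_combination:
  fixes n :: "nat \<Rightarrow> nat" and c :: "nat \<Rightarrow> int"
  assumes S: "add_submonoid S" and min: "minimally_generates A S" and x: "x \<in> A"
    and fin: "finite J" and nJ: "\<And>j. j \<in> J \<Longrightarrow> n j \<in> A" and c: "\<And>j. j \<in> J \<Longrightarrow> c j \<ge> 0"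
    and eq: "int x = (\<Sum>j\<in>J. c j * int (n j))" and k: "k \<in> J" "n k \<noteq> x"
  shows "c k = 0"
proof (rule ccontr)
  assume "c k \<noteq> 0"
  then have ck: "c k \<ge> 1" using c k(1) by force
  have AS: "A \<subseteq> S"
    using min by (rule minimal_generators_subset)
  define r where "r = nat (c k - 1) * n k + (\<Sum>j\<in>J - {k}. nat (c j) * n j)"
  have "nat (c k - 1) * n k \<in> S" "(\<Sum>j\<in>J - {k}. nat (c j) * n j) \<in> S"
    using nJ AS k(1) by (auto intro!: add_submonoid_sum add_submonoid_mult S)
  then have "r \<in> S" using S by (auto simp: r_def add_submonoid_def)
  have "(\<Sum>j\<in>J - {k}. int (nat (c j) * n j)) = (\<Sum>j\<in>J - {k}. c j * int (n j))"
    using c by (intro sum.cong) auto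
  then have "int r = (c k - 1) * int (n k) + (\<Sum>j\<in>J - {k}. c j * int (n j))"
    using ck by (simp add: r_def)
  then have "int x = int (n k) + int r"
    using eq sum.remove[OF fin k(1), of "\<lambda>j. c j * int (n j)"] by (simp add: algebra_simps)
  then have "x = n k + r" by linarith
  then have "n k = 0 \<or> r = 0"
    using minimal_generator_indecomposable[OF min x _ \<open>r \<in> S\<close>] nJ[OF k(1)] AS by auto
  then show False
    using \<open>x = n k + r\<close> k nJ zero_not_minimal_generator[OF min] by fastforce
qed

theorem lemma4p5:
  fixes S :: "nat set" and n :: "nat \<Rightarrow> nat" and m :: nat and s :: int
    and a :: "nat \<Rightarrow> nat \<Rightarrow> int"
  assumes "numerical_semigroup S" and "arf S"
    and "strict_mono_on {1..m} n" and "minimally_generates (n ` {1..m}) S"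
    and "multiplicity S = m" and "m > 5"
    and "conductor S = s"
    and "row_factorization_matrix m n (s - 1) a"
  shows "\<exists>i\<in>{1..m}. \<exists>i'\<in>{1..m}. \<exists>j\<in>{1..m}. i \<noteq> i' \<and> a i j = 0 \<and> a i' j = 0"
proof -
  define A where "A = n ` {1..m}"
  have sub: "add_submonoid S" using assms(1) by (simp add: numerical_semigroup_def)
  have min: "minimally_generates A S" using assms(4) by (simp add: A_def)
  have nA: "n j \<in> A" if "j \<in> {1..m}" for j using that by (simp add: A_def)
  have less: "n i < n j" if "i \<in> {1..m}" "j \<in> {1..m}" "i < j" for i j
    using assms(3) that by (auto simp: strict_mono_on_def)
  have inj: "inj_on n {1..m}" using assms(3) strict_mono_on_imp_inj_on by blast
  have le: "n i \<le> n j" if "i \<in> {1..m}" "j \<in> {1..m}" "i \<le> j" for i j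
    using less[of i j] that by (cases "i = j") auto
  have n1: "n 1 = m"
  proof (rule antisym)
    obtain k where "k \<in> {1..m}" "n k = m"
      using multiplicity_minimal_generator[OF assms(1) min] assms(5) by (auto simp: A_def)
    then show "n 1 \<le> m" using le[of 1 k] by auto
    have "n 1 \<in> A" using nA \<open>m > 5\<close> by simp
    then show "m \<le> n 1"
      using multiplicity_le[OF assms(1), of "n 1"] zero_not_minimal_generator[OF min]
        minimal_generators_subset[OF min] assms(5)
      by (metis subsetD)
  qed
  have "Max A = n m"
    using le assms(6) by (intro Max_eqI) (auto simp: A_def)
  moreover have "card A = m" using inj by (simp add: A_def card_image)
  ultimately have "frobenius_number S = int (n m) - int m"
    using frobenius_number_maximal_embedding_dimension[OF assms(1) min] assms(5,6)
    by (simp add: A_def)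
  then have F: "s - 1 = int (n m) - int m"
    using assms(7) by (simp add: conductor_def)
  have diag: "a i i = -1" and nonneg: "\<And>j. j \<in> {1..m} \<Longrightarrow> j \<noteq> i \<Longrightarrow> a i j \<ge> 0"
    and row: "int (n m) - int m + int (n i) = (\<Sum>j\<in>{1..m} - {i}. a i j * int (n j))"
    if "i \<in> {1..m}" for i
  proof -
    show 1: "a i i = -1" and "\<And>j. j \<in> {1..m} \<Longrightarrow> j \<noteq> i \<Longrightarrow> a i j \<ge> 0"
      using assms(8) that by (auto simp: row_factorization_matrix_def)
    have "s - 1 = (\<Sum>j=1..m. a i j * int (n j))"
      using assms(8) that by (auto simp: row_factorization_matrix_def)
    then show "int (n m) - int m + int (n i) = (\<Sum>j\<in>{1..m} - {i}. a i j * int (n j))"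
      using F 1 that sum.remove[of "{1..m}" i "\<lambda>j. a i j * int (n j)"] by simp
  qed
  have first_row: "a 1 k = 0" if "1 < k" "k < m" for k
  proof (rule minimal_generator_combination[OF sub min, of "n m" "{1..m} - {1}"])
    show "int (n m) = (\<Sum>j\<in>{1..m} - {1}. a 1 j * int (n j))"
      using row[of 1] n1 assms(6) by simp
    show "n k \<noteq> n m" using less[of k m] that by auto
  qed (use nA nonneg that assms(6) in auto)
  show ?thesis
  proof (rule ccontr)
    assume neg: "\<not> ?thesis"
    have pos: "a i 4 \<ge> 1" if "i \<in> {2,3}" for i
    proof -
      have "a i 4 \<noteq> 0"
      proof
        assume "a i 4 = 0"
        moreover have "a 1 4 = 0" "1 \<in> {1..m}" "i \<in> {1..m}" "4 \<in> {1..m}" "1 \<noteq> i"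
          using first_row[of 4] that assms(6) by auto
        ultimately show False using neg by blast
      qed
      moreover have "a i 4 \<ge> 0" using nonneg[of i 4] that assms(6) by auto
      ultimately show ?thesis by linarith
    qed
    have last: "a i m = 0" if "i \<in> {2,3}" for i
    proof (rule ccontr)
      assume "a i m \<noteq> 0"
      have i: "i \<in> {1..m}" "i < 4" using that assms(6) by auto
      then have am: "a i m \<ge> 1"
        using nonneg[of i m] \<open>a i m \<noteq> 0\<close> assms(6) by force
      have "int (n 4) + int (n m) \<le> a i 4 * int (n 4) + a i m * int (n m)"
        using mult_right_mono[OF pos[OF that], of "int (n 4)"]
          mult_right_mono[OF am, of "int (n m)"] by simp
      also have "\<dots> = (\<Sum>j\<in>{4, m}. a i j * int (n j))"
        using assms(6) by simp
      also have "\<dots> \<le> (\<Sum>j\<in>{1..m} - {i}. a i j * int (n j))"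
        using i assms(6) nonneg[OF i(1)] by (intro sum_mono2) auto
      also have "\<dots> = int (n m) - int m + int (n i)"
        using row[OF i(1)] by simp
      finally show False using less[of i 4] i assms(6) by auto
    qed
    have "a 2 m = 0" "a 3 m = 0" "2 \<in> {1..m}" "3 \<in> {1..m}" "m \<in> {1..m}" "(2::nat) \<noteq> 3"
      using last assms(6) by auto
    then show False using neg by blast
  qed
qed

end
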